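(* Let $n\ge1$ be an integer. Given real numbers $0<t<s<1$, there exists a compact set $E\subset\mathbb{R}^n$ such that $\underline{\dim}_{\rm MB}E=\underline{\dim}_{\rm B}E=t$ and $\overline{\dim}_{\rm C}E=\dim_{\rm P}E=s$.
   Context: $B(x,r)$ is the closed Euclidean ball with centre $x$ and radius $r$, and $|A|$ is the diameter of a set $A$. $\mathcal{P}(E)$ is the set of Borel probability measures on $\mathbb{R}^n$ supported by $E$, i.e. with $\mu(\mathbb{R}^n\setminus E)=0$. Box dimension: for non-empty bounded $A\subset\mathbb{R}^n$ and $r>0$, $N_r(A)$ is the least number of sets of diameter $r$ that can cover $A$, and $\underline{\dim}_{\rm B}A=\liminf_{r\to0}\frac{\log N_r(A)}{-\log r}$. Modified lower box dimension: $\underline{\dim}_{\rm MB}E=\inf\{\sup_i\underline{\dim}_{\rm B}E_i:\ E\subset\bigcup_{i=1}^\infty E_i,\ E_i\text{ (non-empty) compact}\}$. Upper correlation dimension: for a Borel probability measure $\mu$, $\overline{\dim}_{\rm C}\mu=\limsup_{r\to0}\frac{\log\int\mu(B(x,r))\,d\mu(x)}{\log r}$, and for a Borel set $E$, $\overline{\dim}_{\rm C}E=\sup_{\mu\in\mathcal{P}(E)}\overline{\dim}_{\rm C}\mu$. Packing dimension: a $\delta$-packing of $E$ is a finite or countable family of disjoint closed balls of radii at most $\delta$ with centres in $E$. For $s\ge0$, let $\mathcal{P}^s_\delta(E)=\sup\{\sum_i|B_i|^s:\{B_i\}\text{ a }\delta\text{-packing of }E\}$, $\mathcal{P}^s_0(E)=\inf_{\delta>0}\mathcal{P}^s_\delta(E)$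 and $\mathcal{P}^s(E)=\inf\{\sum_{i=1}^\infty\mathcal{P}^s_0(E_i):E\subset\bigcup_{i=1}^\infty E_i\}$. Then $\dim_{\rm P}E=\inf\{s\ge0:\mathcal{P}^s(E)=0\}$. *)

theory Defs
  imports "HOL-Probability.Probability"
begin

(* For bounded A and r > 0 a finite cover as below exists, since any set of diameter
   less than r can be enlarged to one of diameter exactly r. Boundedness of the members
   of C is required because the library's diameter has no meaning on unbounded sets. *)
definition covering_number :: "real \<Rightarrow> 'a::euclidean_space set \<Rightarrow> nat" where
  "covering_number r A =
    (LEAST k. \<exists>C. finite C \<and> card C = k \<and> (\<forall>U\<in>C. bounded U \<and> diameter U = r) \<and> A \<subseteq> \<Union>C)"

(* Meant for non-empty bounded A only. *)
definition lower_box_dim :: "'a::euclidean_space set \<Rightarrow> ereal" where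
  "lower_box_dim A =
    Liminf (at_right 0) (\<lambda>r. ereal (ln (real (covering_number r A)) / (- ln r)))"

definition modified_lower_box_dim :: "'a::euclidean_space set \<Rightarrow> ereal" where
  "modified_lower_box_dim E =
    Inf {(SUP i. lower_box_dim (F i)) | F :: nat \<Rightarrow> 'a set.
          (\<forall>i. compact (F i) \<and> F i \<noteq> {}) \<and> E \<subseteq> (\<Union>i. F i)}"

(* Meant for Borel E only: emeasure vanishes by convention on non-measurable sets. *)
definition borel_prob_measures_on :: "'a::euclidean_space set \<Rightarrow> 'a measure set" where
  "borel_prob_measures_on E =
    {\<mu>. prob_space \<mu> \<and> sets \<mu> = sets borel \<and> emeasure \<mu> (UNIV - E) = 0}"

definition upper_correlation_dim_measure :: "'a::euclidean_space measure \<Rightarrow> ereal" where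
  "upper_correlation_dim_measure \<mu> =
    Limsup (at_right 0) (\<lambda>r. ereal (ln (\<integral>x. measure \<mu> (cball x r) \<partial>\<mu>) / ln r))"

definition upper_correlation_dim :: "'a::euclidean_space set \<Rightarrow> ereal" where
  "upper_correlation_dim E =
    (SUP \<mu>\<in>borel_prob_measures_on E. upper_correlation_dim_measure \<mu>)"

(* Balls have positive radius, so disjoint balls are distinct and a packing
   can be represented by the set of its balls. *)
definition is_packing :: "real \<Rightarrow> 'a::euclidean_space set \<Rightarrow> 'a set set \<Rightarrow> bool" where
  "is_packing \<delta> E \<B> \<longleftrightarrow>
    countable \<B> \<and> disjoint \<B> \<and> (\<forall>B\<in>\<B>. \<exists>x\<in>E. \<exists>r. 0 < r \<and> r \<le> \<delta> \<and> B = cball x r)"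

definition packing_content :: "real \<Rightarrow> real \<Rightarrow> 'a::euclidean_space set \<Rightarrow> ennreal" where
  "packing_content s \<delta> E =
    Sup {(\<Sum>\<^sub>\<infinity>B\<in>\<B>. ennreal (diameter B powr s)) | \<B>. is_packing \<delta> E \<B>}"

definition packing_premeasure :: "real \<Rightarrow> 'a::euclidean_space set \<Rightarrow> ennreal" where
  "packing_premeasure s E = (INF \<delta>\<in>{0<..}. packing_content s \<delta> E)"

definition packing_measure :: "real \<Rightarrow> 'a::euclidean_space set \<Rightarrow> ennreal" where
  "packing_measure s E =
    Inf {(\<Sum>i. packing_premeasure s (F i)) | F :: nat \<Rightarrow> 'a set. E \<subseteq> (\<Union>i. F i)}"

definition packing_dim :: "'a::euclidean_space set \<Rightarrow> ereal" where
  "packing_dim E = Inf {ereal s | s. 0 \<le> s \<and> packing_measure s E = 0}"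

end

theory Submission imports Defs begin

text \<open>
  All four dimensions of a compact set \<open>E\<close> are governed by the masses of balls under one probability
  measure \<open>\<mu>\<close> on \<open>E\<close>, so it is enough to find \<open>E\<close>, \<open>\<mu>\<close> and a constant \<open>C\<close> such that, for small \<open>r\<close>,
  \<open>\<mu>(B(x,r)) \<le> C r\<^sup>t\<close> for every \<open>x\<close> and \<open>\<mu>(B(x,r)) \<ge> r\<^sup>s / C\<close> for \<open>x \<in> E\<close>, while for
  suitable arbitrarily small \<open>r\<close> the extreme behaviour occurs uniformly:
  \<open>\<mu>(B(x,r)) \<le> C r\<^sup>s\<close> for every \<open>x\<close>, and, along other scales,
  \<open>\<mu>(B(x,r)) \<ge> r\<^sup>t / C\<close> for every \<open>x \<in> E\<close>.

  The upper bound with exponent \<open>t\<close> makes every set of positive measure need at least a multiple of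
  \<open>r\<^sup>-\<^sup>t\<close> covering sets. Of countably many sets that cover \<open>E\<close> one has positive measure, so even the
  modified lower box dimension is at least \<open>t\<close> (\<open>modified_lower_box_dim_ge\<close>). The frequent lower bound
  with exponent \<open>t\<close> limits the number of disjoint balls centred in \<open>E\<close>, hence the covering number, so
  the lower box dimension is at most \<open>t\<close> (\<open>lower_box_dim_le\<close>).

  The lower bound with exponent \<open>s\<close> gives covers of \<open>E\<close> by at most a multiple of \<open>r\<^sup>-\<^sup>s\<close> balls; any
  probability measure on \<open>E\<close> then puts at least half of its mass on points \<open>x\<close> for which
  \<open>B(x,r)\<close> has mass at least a multiple of \<open>r\<^sup>s\<close>, so the upper correlation dimension is at most \<open>s\<close>
  (\<open>upper_correlation_dim_le\<close>). For exponents above \<open>s\<close> it also bounds the sum over a packing by a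
  vanishing multiple of the total mass of its disjoint balls, so the packing dimension is at most
  \<open>s\<close>. The frequent upper bound with exponent \<open>s\<close> yields the reverse inequalities: directly for the
  correlation integral of \<open>\<mu>\<close> itself, and for the packing dimension because the mass of \<open>closure F\<close> bounds the packing
  premeasure of \<open>F\<close> from below (\<open>measure_closure_le_packing_premeasure\<close>).

  Such a pair exists on a coordinate axis. Choose a set \<open>S\<close> of binary digit positions with lower
  density \<open>t\<close> and upper density \<open>s\<close>, and let \<open>\<mu>\<close> be the distribution of the number whose digits at the
  positions in \<open>S\<close> are independent fair bits and whose other digits are zero. A ball of radius
  \<open>2\<^sup>-\<^sup>m\<close> about a point of the support has mass comparable to
  \<open>2\<^sup>-\<^sup>c\<close>, where \<open>c\<close> is the number of elements of \<open>S\<close> below \<open>m\<close>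
  (\<open>dust_measure_cball_le\<close>, \<open>dust_measure_cball_ge\<close>), so the oscillation of
  \<open>c / m\<close> between \<open>t\<close> and \<open>s\<close> is exactly the required behaviour of \<open>\<mu>\<close>.
\<close>

section \<open>Limits along frequent scales\<close>

lemma Liminf_le_if_frequently_le:
  fixes f g :: "'a \<Rightarrow> ereal"
  assumes "\<exists>\<^sub>F x in F. f x \<le> g x" and "(g \<longlongrightarrow> L) F"
  shows "Liminf F f \<le> L"
proof (rule ccontr)
  assume "\<not> Liminf F f \<le> L"
  then obtain y where y: "L < y" "y < Liminf F f"
    using dense by (auto simp: not_le)
  have "\<forall>\<^sub>F x in F. y < f x" using y(2) by (rule less_LiminfD)
  moreover have "\<forall>\<^sub>F x in F. g x < y" using assms(2) y(1) by (rule order_tendstoD)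
  ultimately have "\<forall>\<^sub>F x in F. \<not> f x \<le> g x" by eventually_elim auto
  with assms(1) show False by (simp add: frequently_def)
qed

lemma Limsup_ge_if_frequently_ge:
  fixes f g :: "'a \<Rightarrow> ereal"
  assumes "\<exists>\<^sub>F x in F. g x \<le> f x" and "(g \<longlongrightarrow> L) F"
  shows "L \<le> Limsup F f"
proof (rule ccontr)
  assume "\<not> L \<le> Limsup F f"
  then obtain y where y: "Limsup F f < y" "y < L"
    using dense by (auto simp: not_le)
  have "\<forall>\<^sub>F x in F. f x < y" using y(1) by (rule Limsup_lessD)
  moreover have "\<forall>\<^sub>F x in F. y < g x" using assms(2) y(2) by (rule order_tendstoD)
  ultimately have "\<forall>\<^sub>F x in F. \<not> g x \<le> f x" by eventually_elim auto
  with assms(1) show False by (simp add: frequently_def)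
qed

text \<open>
  A power law \<open>e\<^sup>a r\<^sup>t\<close> has logarithmic exponent \<open>t + a / ln r\<close>: multiplicative
  constants disappear in the limit.
\<close>

lemma tendsto_add_const_over_ln:
  "((\<lambda>r. ereal (t + a / ln r)) \<longlongrightarrow> ereal t) (at_right 0)"
proof -
  have "((\<lambda>r::real. a / ln r) \<longlongrightarrow> 0) (at_right 0)"
    using ln_at_0 by (intro tendsto_divide_0[OF tendsto_const] filterlim_at_bot_imp_at_infinity)
  from tendsto_add[OF tendsto_const[of t] this] show ?thesis by simp
qed

text \<open>
  For \<open>l = ln r\<close> with \<open>r < 1\<close> this passes between bounds on logarithmic exponents and bounds on logarithms
  of masses; dividing by the negative number \<open>l\<close> reverses the inequality.
\<close>

lemma add_divide_neg_le_divide_iff: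
  fixes l :: real
  assumes "l < 0"
  shows "t + a / l \<le> y / l \<longleftrightarrow> y \<le> a + t * l"
    and "y / l \<le> t + a / l \<longleftrightarrow> a + t * l \<le> y"
proof -
  have "t + a / l = (a + t * l) / l" using assms by (simp add: field_simps)
  then show "t + a / l \<le> y / l \<longleftrightarrow> y \<le> a + t * l"
    and "y / l \<le> t + a / l \<longleftrightarrow> a + t * l \<le> y"
    using assms by (simp_all only: divide_le_cancel) auto
qed

lemma frequently_at_right_0:
  "(\<exists>\<^sub>F r in at_right (0::real). P r) \<longleftrightarrow> (\<forall>e>0. \<exists>r. 0 < r \<and> r < e \<and> P r)"
  unfolding frequently_def eventually_at_right_field by auto

lemma eventually_at_right_0_lt: "0 < e \<Longrightarrow> \<forall>\<^sub>F r in at_right (0::real). 0 < r \<and> r < e"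
  unfolding eventually_at_right_field by auto

section \<open>Coverings and mass\<close>

text \<open>
  Take a set of points of \<open>F\<close> at mutual distances above \<open>2 r\<close> that has the largest possible cardinality.
  The cardinality is bounded because a ball of radius \<open>r\<close> from a finite cover of the closure contains
  at most one such point; by maximality no point of \<open>F\<close> is further than \<open>2 r\<close> from the set.
\<close>

lemma maximal_disjoint_balls:
  fixes F :: "'a::euclidean_space set"
  assumes "bounded F" and "0 < r"
  obtains X where "finite X" "X \<subseteq> F" "disjoint_family_on (\<lambda>x. cball x r) X"
    "F \<subseteq> (\<Union>x\<in>X. cball x (2 * r))"
proof -
  define sep where "sep X \<longleftrightarrow> X \<subseteq> F \<and> (\<forall>x\<in>X. \<forall>y\<in>X. x \<noteq> y \<longrightarrow> 2 * r < dist x y)" for X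
  have "compact (closure F)" using assms(1) by simp
  then obtain K where K: "finite K" "closure F \<subseteq> (\<Union>k\<in>K. ball k r)"
    using assms(2) unfolding compact_eq_totally_bounded by blast
  have sep_bound: "finite X \<and> card X \<le> card K" if "sep X" for X
  proof -
    have "\<forall>x\<in>X. \<exists>k\<in>K. x \<in> ball k r"
      using that K(2) closure_subset unfolding sep_def by fast
    then obtain h where h: "\<And>x. x \<in> X \<Longrightarrow> h x \<in> K \<and> dist (h x) x < r"
      by (metis mem_ball)
    have "inj_on h X"
    proof (rule inj_onI, rule ccontr)
      fix x y assume xy: "x \<in> X" "y \<in> X" "h x = h y" "x \<noteq> y"
      have "dist x y \<le> dist (h x) x + dist (h x) y"
        by (metis dist_commute dist_triangle)
      also have "\<dots> < r + r" using h[OF xy(1)] h[OF xy(2)] xy(3) by (intro add_strict_mono) auto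
      finally show False using that xy unfolding sep_def by force
    qed
    moreover have "h ` X \<subseteq> K" using h by auto
    ultimately show ?thesis using K(1) by (metis card_inj_on_le inj_on_finite)
  qed
  have "sep {}" by (simp add: sep_def)
  then obtain X where X: "sep X" "\<And>Y. sep Y \<Longrightarrow> card Y \<le> card X"
    using ex_has_greatest_nat[of sep "{}" card "Suc (card K)"] sep_bound by (metis le_imp_less_Suc)
  have fin: "finite X" using sep_bound X by auto
  show ?thesis
  proof
    show "finite X" by fact
    show "X \<subseteq> F" using X(1) by (simp add: sep_def)
    show "disjoint_family_on (\<lambda>x. cball x r) X"
      unfolding disjoint_family_on_def
    proof (intro ballI impI equals0I)
      fix x y z assume xy: "x \<in> X" "y \<in> X" "x \<noteq> y" "z \<in> cball x r \<inter> cball y r"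
      then have "dist x y \<le> r + r"
        by (metis IntD1 IntD2 add_mono dist_commute dist_triangle mem_cball order_trans)
      then show False using X(1) xy unfolding sep_def by force
    qed
    show "F \<subseteq> (\<Union>x\<in>X. cball x (2 * r))"
    proof (rule ccontr)
      assume "\<not> ?thesis"
      then obtain y where y: "y \<in> F" "\<And>x. x \<in> X \<Longrightarrow> 2 * r < dist x y" by force
      then have "sep (insert y X)" using X(1) unfolding sep_def by (auto simp: dist_commute)
      moreover have "y \<notin> X" using y(2)[of y] assms(2) by auto
      ultimately show False using X(2)[of "insert y X"] fin by simp
    qed
  qed
qed

lemma covering_number_le:
  assumes "finite X" and "A \<subseteq> (\<Union>x\<in>X. cball x (r / 2))" and "0 < r"
  shows "covering_number r A \<le> card X"
proof -
  let ?C = "(\<lambda>x. cball x (r / 2)) ` X"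
  have "covering_number r A \<le> card ?C"
    unfolding covering_number_def
    by (rule Least_le, rule exI[of _ ?C]) (use assms in auto)
  also have "\<dots> \<le> card X" using assms(1) by (rule card_image_le)
  finally show ?thesis .
qed

text \<open>
  The least element in the definition of the covering number says nothing until some
  finite cover is known to exist; balls of radius \<open>r / 2\<close> have diameter exactly \<open>r\<close> and provide one.
\<close>

lemma covering_number_attained:
  fixes A :: "'a::euclidean_space set"
  assumes "bounded A" and "0 < r"
  obtains C where "finite C" "card C = covering_number r A"
    "\<And>U. U \<in> C \<Longrightarrow> bounded U \<and> diameter U = r" "A \<subseteq> \<Union>C"
proof -
  have "0 < r / 4" using assms(2) by simp
  then obtain X where X: "finite X" "A \<subseteq> (\<Union>x\<in>X. cball x (2 * (r / 4)))"
    using maximal_disjoint_balls[OF assms(1)] by metis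
  let ?P = "\<lambda>k. \<exists>C. finite C \<and> card C = k \<and> (\<forall>U\<in>C. bounded U \<and> diameter U = r) \<and> A \<subseteq> \<Union>C"
  have "?P (card ((\<lambda>x. cball x (2 * (r / 4))) ` X))"
    by (rule exI[of _ "(\<lambda>x. cball x (2 * (r / 4))) ` X"]) (use X assms(2) in auto)
  then have "?P (covering_number r A)" unfolding covering_number_def by (rule LeastI)
  then obtain C where "finite C" "card C = covering_number r A"
      "\<forall>U\<in>C. bounded U \<and> diameter U = r" "A \<subseteq> \<Union>C"
    by blast
  then show ?thesis by (intro that[of C]) auto
qed

lemma covering_number_pos:
  fixes A :: "'a::euclidean_space set"
  assumes "bounded A" and "0 < r" and "A \<noteq> {}"
  shows "1 \<le> covering_number r A"
proof -
  obtain C where "finite C" "card C = covering_number r A" "A \<subseteq> \<Union>C"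
    using covering_number_attained[OF assms(1,2)] by metis
  then show ?thesis using assms(3) by (cases "C = {}") (auto simp: Suc_le_eq card_gt_0_iff)
qed

text \<open>
  Disjoint balls of mass at least \<open>m\<close> number at most \<open>1 / m\<close>, and doubling a maximal disjoint family
  of balls gives a cover.
\<close>

lemma ball_cover_of_mass_lower_bound:
  fixes \<mu> :: "'a::euclidean_space measure"
  assumes "prob_space \<mu>" and "sets \<mu> = sets borel" and "bounded E" and "0 < r" and "0 < m"
    and mass: "\<And>x. x \<in> E \<Longrightarrow> m \<le> measure \<mu> (cball x r)"
  obtains X where "finite X" "E \<subseteq> (\<Union>x\<in>X. cball x (2 * r))" "real (card X) \<le> 1 / m"
proof -
  interpret prob_space \<mu> by fact
  obtain X where X: "finite X" "X \<subseteq> E" "disjoint_family_on (\<lambda>x. cball x r) X"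
      "E \<subseteq> (\<Union>x\<in>X. cball x (2 * r))"
    using maximal_disjoint_balls[OF assms(3,4)] .
  have "real (card X) * m = (\<Sum>x\<in>X. m)" by simp
  also have "\<dots> \<le> (\<Sum>x\<in>X. prob (cball x r))" using X(2) mass by (intro sum_mono) auto
  also have "\<dots> = prob (\<Union>x\<in>X. cball x r)"
    using X assms(2) by (intro finite_measure_finite_Union[symmetric]) auto
  also have "\<dots> \<le> 1" by simp
  finally show ?thesis using that X assms(5) by (simp add: field_simps)
qed

section \<open>Lower box dimension\<close>

text \<open>
  Mass distribution principle: a set of diameter \<open>r\<close> lies in a ball of radius \<open>r\<close> about any of its points and
  so has mass at most \<open>C r\<^sup>t\<close>. A cover must capture the whole mass of \<open>F\<close>, which forces at least
  a constant multiple of \<open>r\<^sup>-\<^sup>t\<close> sets.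
\<close>

lemma lower_box_dim_ge:
  fixes F :: "'a::euclidean_space set"
  assumes "prob_space \<mu>" and "sets \<mu> = sets borel" and "bounded F" and "0 < C"
    and pos: "0 < emeasure \<mu> F"
    and mass: "\<And>x r. 0 < r \<Longrightarrow> r < 1 \<Longrightarrow> measure \<mu> (cball x r) \<le> C * r powr t"
  shows "ereal t \<le> lower_box_dim F"
proof -
  interpret prob_space \<mu> by fact
  have meas: "F \<in> sets \<mu>" using pos emeasure_notin_sets by force
  define p where "p = prob F"
  have p: "0 < p" using pos by (simp add: p_def emeasure_eq_measure)
  have bound: "ereal (t + (- ln (p / C)) / ln r)
      \<le> ereal (ln (real (covering_number r F)) / (- ln r))" if r: "0 < r" "r < 1" for r
  proof -
    obtain \<C> where \<C>: "finite \<C>" "card \<C> = covering_number r F"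
      "\<And>U. U \<in> \<C> \<Longrightarrow> bounded U \<and> diameter U = r" "F \<subseteq> \<Union>\<C>"
      using covering_number_attained[OF assms(3) r(1)] by metis
    define c where "c U = (SOME x. x \<in> U)" for U :: "'a set"
    have sub: "U \<subseteq> cball (c U) r" if U: "U \<in> \<C>" for U
    proof
      fix y assume "y \<in> U"
      moreover from this have "c U \<in> U" unfolding c_def by (rule someI)
      ultimately show "y \<in> cball (c U) r"
        using \<C>(3)[OF U] diameter_bounded_bound[of U "c U" y] by simp
    qed
    have "F \<subseteq> (\<Union>U\<in>\<C>. cball (c U) r)" using \<C>(4) sub by blast
    then have "p \<le> prob (\<Union>U\<in>\<C>. cball (c U) r)"
      unfolding p_def using meas \<C>(1) assms(2) by (intro finite_measure_mono) auto
    also have "\<dots> \<le> (\<Sum>U\<in>\<C>. prob (cball (c U) r))"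
      by (rule finite_measure_subadditive_finite[OF \<C>(1)]) (simp add: assms(2) image_subset_iff)
    also have "\<dots> \<le> (\<Sum>U\<in>\<C>. C * r powr t)" using mass r by (intro sum_mono) auto
    finally have le: "p / C \<le> real (covering_number r F) * r powr t"
      using \<C>(2) assms(4) by (simp add: field_simps)
    have N: "0 < real (covering_number r F)"
    proof (rule ccontr)
      assume "\<not> ?thesis"
      then show False using le p assms(4) by (simp add: field_simps)
    qed
    have "ln (p / C) \<le> ln (real (covering_number r F) * r powr t)"
      using le p assms(4) by (intro ln_mono) auto
    also have "\<dots> = ln (real (covering_number r F)) + t * ln r"
      using N r by (simp add: ln_mult ln_powr)
    finally have "ln (p / C) \<le> ln (real (covering_number r F)) + t * ln r" .
    moreover have "ln r < 0" using r by simp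
    ultimately show ?thesis
      using add_divide_neg_le_divide_iff(1)[of "ln r" t "- ln (p / C)"
          "- ln (real (covering_number r F))"] by simp
  qed
  have "ereal t = Liminf (at_right 0) (\<lambda>r. ereal (t + (- ln (p / C)) / ln r))"
    by (intro lim_imp_Liminf[symmetric] tendsto_add_const_over_ln) simp
  also have "\<dots> \<le> lower_box_dim F"
    unfolding lower_box_dim_def
    using eventually_at_right_0_lt[of 1] bound by (intro Liminf_mono) (auto elim: eventually_mono)
  finally show ?thesis .
qed

lemma lower_box_dim_le:
  fixes E :: "'a::euclidean_space set"
  assumes "prob_space \<mu>" and "sets \<mu> = sets borel" and "bounded E" and "E \<noteq> {}" and "0 < C"
    and mass: "\<exists>\<^sub>F r in at_right 0. \<forall>x\<in>E. r powr t / C \<le> measure \<mu> (cball x r)"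
  shows "lower_box_dim E \<le> ereal t"
  unfolding lower_box_dim_def
proof (rule Liminf_le_if_frequently_le)
  define a where "a = - ln (C * 4 powr t)"
  show "((\<lambda>r. ereal (t + a / ln r)) \<longlongrightarrow> ereal t) (at_right 0)"
    by (rule tendsto_add_const_over_ln)
  show "\<exists>\<^sub>F r in at_right 0. ereal (ln (real (covering_number r E)) / (- ln r)) \<le> ereal (t + a / ln r)"
    unfolding frequently_at_right_0
  proof (intro allI impI)
    fix e :: real assume "0 < e"
    then have "0 < min e 1 / 4" by simp
    then obtain \<rho> where \<rho>: "0 < \<rho>" "\<rho> < min e 1 / 4"
        "\<And>x. x \<in> E \<Longrightarrow> \<rho> powr t / C \<le> measure \<mu> (cball x \<rho>)"
      using mass unfolding frequently_at_right_0 by blast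
    \<comment> \<open>doubling the disjoint balls of radius \<open>\<rho>\<close> gives covering sets of diameter \<open>4 \<rho>\<close>\<close>
    define r where "r = 4 * \<rho>"
    have r: "0 < r" "r < e" "r < 1" "\<rho> = r / 4" using \<rho> by (auto simp: r_def)
    have "0 < \<rho> powr t / C" using \<rho>(1) assms(5) by simp
    from ball_cover_of_mass_lower_bound[OF assms(1-3) \<rho>(1) this \<rho>(3)]
    obtain X where X: "finite X" "E \<subseteq> (\<Union>x\<in>X. cball x (2 * \<rho>))"
        "real (card X) \<le> 1 / (\<rho> powr t / C)"
      by metis
    have "covering_number r E \<le> card X" using X r by (intro covering_number_le) auto
    then have "real (covering_number r E) \<le> real (card X)" by simp
    also have "\<dots> \<le> (C * 4 powr t) * r powr (- t)"
      using X(3) r \<rho>(1) by (simp add: powr_divide powr_minus field_simps)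
    finally have "ln (real (covering_number r E)) \<le> ln ((C * 4 powr t) * r powr (- t))"
      using covering_number_pos[OF assms(3) r(1) assms(4)] by (intro ln_mono) auto
    also have "\<dots> = - a - t * ln r"
      unfolding a_def using r assms(5) by (simp add: ln_mult ln_powr)
    finally have "ln (real (covering_number r E)) \<le> - a - t * ln r" .
    moreover have "ln r < 0" using r by simp
    ultimately have "ln (real (covering_number r E)) / (- ln r) \<le> t + a / ln r"
      using add_divide_neg_le_divide_iff(2)[of "ln r" "- ln (real (covering_number r E))" t a]
      by simp
    then show "\<exists>r. 0 < r \<and> r < e \<and>
        ereal (ln (real (covering_number r E)) / (- ln r)) \<le> ereal (t + a / ln r)"
      using r by auto
  qed
qed

lemma measure_eq_1_of_superset:
  assumes \<mu>: "\<mu> \<in> borel_prob_measures_on E"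
    and "E \<in> sets borel" and "A \<in> sets borel" and "E \<subseteq> A"
  shows "measure \<mu> A = 1"
proof -
  interpret prob_space \<mu> using \<mu> by (simp add: borel_prob_measures_on_def)
  have sets: "sets \<mu> = sets borel" using \<mu> by (simp add: borel_prob_measures_on_def)
  have space: "space \<mu> = UNIV" using sets_eq_imp_space_eq[OF sets] by simp
  have "prob (space \<mu> - E) = 0" using \<mu> space by (simp add: borel_prob_measures_on_def measure_def)
  then have "prob E = 1" using assms(2) sets prob_compl[of E] by simp
  moreover have "prob E \<le> prob A" using assms sets by (intro finite_measure_mono) auto
  ultimately show ?thesis using prob_le_1[of A] by simp
qed

text \<open>
  By countable additivity some member of any countable cover of \<open>E\<close> has positive measure, and the mass
  distribution principle applies to it.
\<close>

lemma modified_lower_box_dim_ge: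
  fixes E :: "'a::euclidean_space set"
  assumes \<mu>: "\<mu> \<in> borel_prob_measures_on E" and "E \<in> sets borel" and "0 < C"
    and mass: "\<And>x r. 0 < r \<Longrightarrow> r < 1 \<Longrightarrow> measure \<mu> (cball x r) \<le> C * r powr t"
  shows "ereal t \<le> modified_lower_box_dim E"
  unfolding modified_lower_box_dim_def
proof (rule Inf_greatest, clarify)
  fix F :: "nat \<Rightarrow> 'a set"
  assume F: "\<forall>i. compact (F i) \<and> F i \<noteq> {}" "E \<subseteq> (\<Union>i. F i)"
  interpret prob_space \<mu> using \<mu> by (simp add: borel_prob_measures_on_def)
  have sets: "sets \<mu> = sets borel" using \<mu> by (simp add: borel_prob_measures_on_def)
  have Fm: "F i \<in> sets \<mu>" for i using F(1) sets by (auto intro: borel_compact)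
  have "\<exists>i. 0 < emeasure \<mu> (F i)"
  proof (rule ccontr)
    assume "\<not> ?thesis"
    then have "emeasure \<mu> (\<Union>i. F i) = 0" using Fm by (intro emeasure_UN_eq_0) auto
    moreover have "prob (\<Union>i. F i) = 1"
      using Fm sets F(2) by (intro measure_eq_1_of_superset[OF \<mu> assms(2)]) auto
    ultimately show False by (simp add: measure_def)
  qed
  then obtain i where "0 < emeasure \<mu> (F i)" by blast
  then have "ereal t \<le> lower_box_dim (F i)"
    using F(1) sets assms(3) mass by (intro lower_box_dim_ge[where \<mu> = \<mu> and C = C])
      (auto simp: prob_space_axioms compact_imp_bounded)
  also have "\<dots> \<le> (SUP i. lower_box_dim (F i))" by (rule SUP_upper) simp
  finally show "ereal t \<le> (SUP i. lower_box_dim (F i))" .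
qed

lemma modified_lower_box_dim_le_lower_box_dim:
  assumes "compact E" and "E \<noteq> {}"
  shows "modified_lower_box_dim E \<le> lower_box_dim E"
  unfolding modified_lower_box_dim_def
  by (rule Inf_lower, clarsimp, rule exI[of _ "\<lambda>_. E"]) (use assms in auto)

section \<open>Upper correlation dimension\<close>

text \<open>
  The balls are the sections of the closed set of pairs at distance at most \<open>r\<close>. Without measurability
  the Bochner integral in the definition of the correlation dimension would be zero by convention.
\<close>

lemma borel_measurable_measure_cball:
  fixes \<nu> :: "'a::euclidean_space measure"
  assumes "prob_space \<nu>" and sets: "sets \<nu> = sets borel"
  shows "(\<lambda>x. measure \<nu> (cball x r)) \<in> borel_measurable \<nu>"
proof -
  interpret prob_space \<nu> by fact
  let ?D = "{p :: 'a \<times> 'a. dist (fst p) (snd p) \<le> r}"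
  have "closed ?D" by (intro closed_Collect_le continuous_intros)
  then have "?D \<in> sets (borel \<Otimes>\<^sub>M borel)"
    unfolding borel_prod by (rule borel_closed)
  then have "?D \<in> sets (\<nu> \<Otimes>\<^sub>M \<nu>)" using sets_pair_measure_cong[OF sets sets] by simp
  from measurable_emeasure_Pair[OF this]
  have "(\<lambda>x. emeasure \<nu> (Pair x -` ?D)) \<in> borel_measurable \<nu>" .
  moreover have "Pair x -` ?D = cball x r" for x :: 'a by auto
  ultimately show ?thesis unfolding measure_def by simp
qed

text \<open>
  Call \<open>x\<close> bad if \<open>B(x,r)\<close> has mass at most \<open>\<eta> = 1 / (2 N)\<close>, where \<open>N\<close> is the number of balls in the
  cover. The bad points in one ball of radius \<open>r / 2\<close> lie in \<open>B(y,r)\<close> for any bad \<open>y\<close> among them, so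
  they have mass at most \<open>\<eta>\<close>, and all bad points together have mass at most \<open>1 / 2\<close>. The integrand
  exceeds \<open>\<eta>\<close> on the remaining half of the mass.
\<close>

lemma integral_measure_cball_ge:
  fixes \<nu> :: "'a::euclidean_space measure"
  assumes \<nu>: "\<nu> \<in> borel_prob_measures_on E" and "E \<in> sets borel"
    and X: "finite X" "E \<subseteq> (\<Union>x\<in>X. cball x (r / 2))"
  shows "1 / (4 * real (card X)) \<le> (\<integral>x. measure \<nu> (cball x r) \<partial>\<nu>)"
proof -
  interpret prob_space \<nu> using \<nu> by (simp add: borel_prob_measures_on_def)
  have sets: "sets \<nu> = sets borel" using \<nu> by (simp add: borel_prob_measures_on_def)
  have space: "space \<nu> = UNIV" using sets_eq_imp_space_eq[OF sets] by simp
  define f where "f x = prob (cball x r)" for x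
  have f: "f \<in> borel_measurable \<nu>"
    unfolding f_def using prob_space_axioms sets by (rule borel_measurable_measure_cball)
  have int: "integrable \<nu> f"
    by (rule integrable_const_bound[of _ 1]) (use f in \<open>auto simp: f_def\<close>)
  have "X \<noteq> {}"
  proof
    assume "X = {}"
    then show False using measure_eq_1_of_superset[OF \<nu> assms(2), of "{}"] X by simp
  qed
  then have N: "0 < real (card X)" using X(1) by (simp add: card_gt_0_iff)
  define \<eta> where "\<eta> = 1 / (2 * real (card X))"
  define G where "G = {x \<in> space \<nu>. \<eta> < f x}"
  have G: "G \<in> sets \<nu>" unfolding G_def using f by measurable
  have small: "prob (cball x (r / 2) - G) \<le> \<eta>" for x
  proof (cases "cball x (r / 2) - G = {}")
    case False
    then obtain y where y: "y \<in> cball x (r / 2)" "y \<notin> G" by blast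
    have "cball x (r / 2) - G \<subseteq> cball y r"
    proof
      fix z assume "z \<in> cball x (r / 2) - G"
      then show "z \<in> cball y r"
        using y(1) dist_triangle2[of y z x] by (simp add: dist_commute)
    qed
    then have "prob (cball x (r / 2) - G) \<le> f y"
      unfolding f_def using sets by (intro finite_measure_mono) auto
    then show ?thesis using y(2) space unfolding G_def by simp
  next
    case True
    have "prob (cball x (r / 2) - G) = 0" by (simp only: True measure_empty)
    then show ?thesis using N by (simp add: \<eta>_def)
  qed
  have D: "cball x (r / 2) - G \<in> sets \<nu>" for x using G by (simp add: sets sets.Diff)
  then have U: "(\<Union>x\<in>X. cball x (r / 2) - G) \<in> sets \<nu>" using X(1) by (intro sets.finite_UN)
  have "(\<Union>x\<in>X. cball x (r / 2) - G) \<union> G \<in> sets borel" using sets.Un[OF U G] by (simp only: sets)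
  then have "1 = prob ((\<Union>x\<in>X. cball x (r / 2) - G) \<union> G)"
    by (rule measure_eq_1_of_superset[OF \<nu> assms(2), symmetric]) (use X(2) in blast)
  also have "\<dots> \<le> prob (\<Union>x\<in>X. cball x (r / 2) - G) + prob G"
    using U G by (rule measure_Un_le)
  also have "prob (\<Union>x\<in>X. cball x (r / 2) - G) \<le> (\<Sum>x\<in>X. prob (cball x (r / 2) - G))"
    by (rule finite_measure_subadditive_finite[OF X(1)]) (use D in blast)
  also have "\<dots> \<le> (\<Sum>x\<in>X. \<eta>)" using small by (intro sum_mono)
  also have "\<dots> = 1 / 2" using N by (simp add: \<eta>_def)
  finally have half: "1 / 2 \<le> prob G" by simp
  have "1 / (4 * real (card X)) = \<eta> * (1 / 2)" by (simp add: \<eta>_def)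
  also have "\<dots> \<le> \<eta> * prob G" using half N by (intro mult_left_mono) (auto simp: \<eta>_def)
  also have "\<dots> = (\<integral>x. \<eta> * indicator G x \<partial>\<nu>)" using G by simp
  also have "\<dots> \<le> (\<integral>x. f x \<partial>\<nu>)"
  proof (rule integral_mono)
    show "integrable \<nu> (\<lambda>x. \<eta> * indicator G x)" using G by (simp add: emeasure_eq_measure)
    show "\<eta> * indicator G x \<le> f x" for x
      by (cases "x \<in> G") (auto simp: G_def f_def)
  qed (rule int)
  finally show ?thesis by (simp add: f_def)
qed

lemma upper_correlation_dim_le:
  fixes E :: "'a::euclidean_space set"
  assumes \<mu>: "prob_space \<mu>" "sets \<mu> = sets borel" and "compact E" and "0 < C"
    and mass: "\<And>x r. x \<in> E \<Longrightarrow> 0 < r \<Longrightarrow> r < 1 \<Longrightarrow> r powr s / C \<le> measure \<mu> (cball x r)"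
  shows "upper_correlation_dim E \<le> ereal s"
  unfolding upper_correlation_dim_def
proof (rule SUP_least)
  fix \<nu> assume \<nu>: "\<nu> \<in> borel_prob_measures_on E"
  define a where "a = ln (1 / (4 * C * 4 powr s))"
  have bound: "ereal (ln (\<integral>x. measure \<nu> (cball x r) \<partial>\<nu>) / ln r) \<le> ereal (s + a / ln r)"
    if r: "0 < r" "r < 1" for r
  proof -
    have r4: "0 < r / 4" "r / 4 < 1" and "0 < (r / 4) powr s / C" using r assms(4) by auto
    from ball_cover_of_mass_lower_bound[OF \<mu> compact_imp_bounded[OF assms(3)] r4(1) this(3)
        mass[OF _ r4]]
    obtain X where X: "finite X" "E \<subseteq> (\<Union>x\<in>X. cball x (2 * (r / 4)))"
        "real (card X) \<le> 1 / ((r / 4) powr s / C)"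
      by metis
    have I: "1 / (4 * real (card X)) \<le> (\<integral>x. measure \<nu> (cball x r) \<partial>\<nu>)"
      using X assms(3) by (intro integral_measure_cball_ge[OF \<nu>]) (auto intro: borel_compact)
    have "X \<noteq> {}"
    proof
      assume "X = {}"
      then show False
        using measure_eq_1_of_superset[OF \<nu> borel_compact[OF assms(3)], of "{}"] X by simp
    qed
    then have N: "0 < real (card X)" using X(1) by (simp add: card_gt_0_iff)
    have "1 / (4 * C * 4 powr s) * r powr s \<le> 1 / (4 * real (card X))"
      using X(3) N r assms(4) by (simp add: powr_divide field_simps)
    with I have I': "1 / (4 * C * 4 powr s) * r powr s \<le> (\<integral>x. measure \<nu> (cball x r) \<partial>\<nu>)" by simp
    have "a + s * ln r = ln (1 / (4 * C * 4 powr s) * r powr s)"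
      unfolding a_def using r assms(4) by (subst ln_mult) (auto simp: ln_powr)
    also have "\<dots> \<le> ln (\<integral>x. measure \<nu> (cball x r) \<partial>\<nu>)"
      using I' r assms(4) by (intro ln_mono) auto
    finally have "a + s * ln r \<le> ln (\<integral>x. measure \<nu> (cball x r) \<partial>\<nu>)" .
    moreover have "ln r < 0" using r by simp
    ultimately show ?thesis by (simp add: add_divide_neg_le_divide_iff)
  qed
  have "upper_correlation_dim_measure \<nu> \<le> Limsup (at_right 0) (\<lambda>r. ereal (s + a / ln r))"
    unfolding upper_correlation_dim_measure_def
    using eventually_at_right_0_lt[of 1] bound by (intro Limsup_mono) (auto elim: eventually_mono)
  also have "\<dots> = ereal s"
    by (intro lim_imp_Limsup tendsto_add_const_over_ln) simp
  finally show "upper_correlation_dim_measure \<nu> \<le> ereal s" .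
qed

lemma upper_correlation_dim_ge:
  fixes E :: "'a::euclidean_space set"
  assumes \<mu>: "\<mu> \<in> borel_prob_measures_on E" and "compact E" and "0 < C"
    and mass: "\<exists>\<^sub>F r in at_right 0. \<forall>x. measure \<mu> (cball x r) \<le> C * r powr s"
  shows "ereal s \<le> upper_correlation_dim E"
proof -
  interpret prob_space \<mu> using \<mu> by (simp add: borel_prob_measures_on_def)
  have sets: "sets \<mu> = sets borel" using \<mu> by (simp add: borel_prob_measures_on_def)
  have "ereal s \<le> upper_correlation_dim_measure \<mu>"
    unfolding upper_correlation_dim_measure_def
  proof (rule Limsup_ge_if_frequently_ge)
    show "((\<lambda>r. ereal (s + ln C / ln r)) \<longlongrightarrow> ereal s) (at_right 0)"
      by (rule tendsto_add_const_over_ln)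
    have bound: "ereal (s + ln C / ln r) \<le> ereal (ln (\<integral>x. prob (cball x r) \<partial>\<mu>) / ln r)"
      if r: "0 < r" "r < 1" and m: "\<forall>x. prob (cball x r) \<le> C * r powr s" for r
    proof -
      have "0 < r / 4" using r by simp
      then obtain X where X: "finite X" "E \<subseteq> (\<Union>x\<in>X. cball x (2 * (r / 4)))"
        using maximal_disjoint_balls[OF compact_imp_bounded[OF assms(2)]] by metis
      have "X \<noteq> {}"
      proof
        assume "X = {}"
        then show False
          using measure_eq_1_of_superset[OF \<mu> borel_compact[OF assms(2)], of "{}"] X by simp
      qed
      then have "0 < 1 / (4 * real (card X))" using X(1) by (simp add: card_gt_0_iff)
      also have "\<dots> \<le> (\<integral>x. prob (cball x r) \<partial>\<mu>)"
        using X assms(2) by (intro integral_measure_cball_ge[OF \<mu>]) (auto intro: borel_compact)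
      finally have pos: "0 < (\<integral>x. prob (cball x r) \<partial>\<mu>)" .
      have "integrable \<mu> (\<lambda>x. prob (cball x r))"
        by (rule integrable_const_bound[of _ 1])
          (use borel_measurable_measure_cball[OF prob_space_axioms sets] in auto)
      then have "(\<integral>x. prob (cball x r) \<partial>\<mu>) \<le> (\<integral>x. C * r powr s \<partial>\<mu>)"
        using m by (intro integral_mono) auto
      then have "(\<integral>x. prob (cball x r) \<partial>\<mu>) \<le> C * r powr s" by (simp add: prob_space)
      then have "ln (\<integral>x. prob (cball x r) \<partial>\<mu>) \<le> ln (C * r powr s)"
        using pos by (intro ln_mono) auto
      also have "\<dots> = ln C + s * ln r" using r assms(3) by (simp add: ln_mult ln_powr)
      finally have "ln (\<integral>x. prob (cball x r) \<partial>\<mu>) \<le> ln C + s * ln r" .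
      moreover have "ln r < 0" using r by simp
      ultimately show ?thesis by (simp add: add_divide_neg_le_divide_iff)
    qed
    show "\<exists>\<^sub>F r in at_right 0.
        ereal (s + ln C / ln r) \<le> ereal (ln (\<integral>x. prob (cball x r) \<partial>\<mu>) / ln r)"
      by (rule frequently_rev_mp[OF mass], rule eventually_mono[OF eventually_at_right_0_lt[of 1]])
        (use bound in auto)
  qed
  also have "\<dots> \<le> upper_correlation_dim E"
    unfolding upper_correlation_dim_def using \<mu> by (rule SUP_upper)
  finally show ?thesis .
qed

section \<open>Packing dimension\<close>

text \<open>
  For a ball \<open>B\<close> of radius \<open>r \<le> \<delta>\<close> centred in \<open>E\<close>, \<open>|B|\<close> to the power \<open>s'\<close> is at most a constant times
  \<open>\<delta>\<close> to the power \<open>s' - s\<close> times \<open>\<mu>(B)\<close>. Disjointness bounds the sum of the masses by one, so the packing content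
  tends to zero with \<open>\<delta>\<close>.
\<close>

lemma packing_measure_eq_0:
  fixes E :: "'a::euclidean_space set"
  assumes \<mu>: "prob_space \<mu>" "sets \<mu> = sets borel" and "0 < C" and "s < s'"
    and mass: "\<And>x r. x \<in> E \<Longrightarrow> 0 < r \<Longrightarrow> r < 1 \<Longrightarrow> r powr s / C \<le> measure \<mu> (cball x r)"
  shows "packing_measure s' E = 0"
proof -
  interpret prob_space \<mu> by fact
  define K where "K = C * 2 powr s'"
  have K: "0 < K" using assms(3) by (simp add: K_def)
  have content: "packing_content s' \<delta> E \<le> ennreal (K * \<delta> powr (s' - s))"
    if \<delta>: "0 < \<delta>" "\<delta> < 1" for \<delta>
    unfolding packing_content_def
  proof (rule Sup_least, clarify)
    fix \<B> :: "'a set set" assume \<B>: "is_packing \<delta> E \<B>"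
    have ball: "diameter B powr s' \<le> K * \<delta> powr (s' - s) * prob B \<and> B \<in> sets \<mu>"
      if B: "B \<in> \<B>" for B
    proof -
      obtain x r where x: "x \<in> E" "0 < r" "r \<le> \<delta>" "B = cball x r"
        using \<B> B unfolding is_packing_def by blast
      have "diameter B powr s' = 2 powr s' * (r powr (s' - s) * r powr s)"
        using x by (simp add: powr_mult flip: powr_add)
      also have "\<dots> \<le> 2 powr s' * (\<delta> powr (s' - s) * (C * prob B))"
        using x mass[of x r] \<delta> assms(3,4)
        by (intro mult_left_mono mult_mono powr_mono2) (auto simp: field_simps)
      finally show ?thesis using x(4) \<mu>(2) by (simp add: K_def mult_ac)
    qed
    show "(\<Sum>\<^sub>\<infinity>B\<in>\<B>. ennreal (diameter B powr s')) \<le> ennreal (K * \<delta> powr (s' - s))"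
    proof (subst nonneg_infsum_complete, simp, rule SUP_least, clarify)
      fix \<F> assume \<F>: "finite \<F>" "\<F> \<subseteq> \<B>"
      have "(\<Sum>B\<in>\<F>. diameter B powr s') \<le> (\<Sum>B\<in>\<F>. K * \<delta> powr (s' - s) * prob B)"
        using \<F>(2) ball by (intro sum_mono) auto
      also have "\<dots> = K * \<delta> powr (s' - s) * (\<Sum>B\<in>\<F>. prob B)" by (simp add: sum_distrib_left)
      also have "(\<Sum>B\<in>\<F>. prob B) = prob (\<Union>B\<in>\<F>. B)"
      proof (rule finite_measure_finite_Union[symmetric, OF \<F>(1)])
        show "(\<lambda>B. B) ` \<F> \<subseteq> sets \<mu>" using \<F>(2) ball by auto
        show "disjoint_family_on (\<lambda>B. B) \<F>"
          using \<B> \<F>(2) unfolding is_packing_def disjoint_family_on_def disjoint_def by blast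
      qed
      also have "K * \<delta> powr (s' - s) * prob (\<Union>B\<in>\<F>. B) \<le> K * \<delta> powr (s' - s) * 1"
        using K by (intro mult_left_mono) auto
      finally show "(\<Sum>B\<in>\<F>. ennreal (diameter B powr s')) \<le> ennreal (K * \<delta> powr (s' - s))"
        by (simp add: sum_ennreal ennreal_leI)
    qed
  qed
  have "packing_premeasure s' E \<le> 0"
  proof (rule tendsto_lowerbound)
    have "((\<lambda>\<delta>. K * \<delta> powr (s' - s)) \<longlongrightarrow> K * 0) (at_right 0)"
      using assms(4)
      by (intro tendsto_mult tendsto_const tendsto_zero_powrI[where b = "s' - s"])
        (auto intro: tendsto_eq_intros eventually_at_rightI[of 0 1])
    from tendsto_ennrealI[OF this]
    show "((\<lambda>\<delta>. ennreal (K * \<delta> powr (s' - s))) \<longlongrightarrow> 0) (at_right 0)"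
      by simp
    have "packing_premeasure s' E \<le> packing_content s' \<delta> E" if "0 < \<delta>" for \<delta>
      unfolding packing_premeasure_def using that by (intro INF_lower) simp
    then show "\<forall>\<^sub>F \<delta> in at_right 0. packing_premeasure s' E \<le> ennreal (K * \<delta> powr (s' - s))"
      using eventually_at_right_0_lt[of 1] content by (force elim: eventually_mono intro: order_trans)
  qed simp
  then have "packing_premeasure s' E = 0" by simp
  moreover have "packing_measure s' E \<le> (\<Sum>i::nat. packing_premeasure s' E)"
    unfolding packing_measure_def by (rule Inf_lower) (auto intro!: exI[of _ "\<lambda>_. E"])
  ultimately show ?thesis by simp
qed

text \<open>
  At a scale \<open>\<rho>\<close> where all balls satisfy the upper bound, take a maximal disjoint family of balls of radius
  \<open>\<rho> / 2\<close> centred in \<open>F\<close>. It is a packing, and the doubled balls form a finite closed cover, so they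
  cover \<open>closure F\<close> too and their masses add up to at least that of the closure. Passing to the closure makes
  the estimate meaningful for sets \<open>F\<close> that are not measurable.
\<close>

lemma measure_closure_le_packing_premeasure:
  fixes F :: "'a::euclidean_space set"
  assumes \<mu>: "prob_space \<mu>" "sets \<mu> = sets borel" and "bounded F" and "0 < C" and "s' \<le> s"
    and mass: "\<exists>\<^sub>F r in at_right 0. \<forall>x. measure \<mu> (cball x r) \<le> C * r powr s"
  shows "emeasure \<mu> (closure F) \<le> ennreal C * packing_premeasure s' F"
proof -
  interpret prob_space \<mu> by fact
  have "ennreal (prob (closure F) / C) \<le> packing_premeasure s' F"
    unfolding packing_premeasure_def
  proof (rule INF_greatest)
    fix \<delta> :: real assume "\<delta> \<in> {0<..}"
    then have "0 < min \<delta> 1" by simp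
    then obtain \<rho> where \<rho>: "0 < \<rho>" "\<rho> < min \<delta> 1" "\<And>x. prob (cball x \<rho>) \<le> C * \<rho> powr s"
      using mass unfolding frequently_at_right_0 by blast
    \<comment> \<open>half of the good scale, so that the doubled balls are the ones with known mass\<close>
    define r where "r = \<rho> / 2"
    have r: "0 < r" "r \<le> \<delta>" "\<rho> = 2 * r" using \<rho> by (auto simp: r_def)
    obtain X where X: "finite X" "X \<subseteq> F" "disjoint_family_on (\<lambda>x. cball x r) X"
        "F \<subseteq> (\<Union>x\<in>X. cball x (2 * r))"
      using maximal_disjoint_balls[OF assms(3) r(1)] .
    have inj: "inj_on (\<lambda>x. cball x r) X"
      using r(1) by (auto simp: inj_on_def cball_eq_cball_iff)
    have packing: "is_packing \<delta> F ((\<lambda>x. cball x r) ` X)"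
      unfolding is_packing_def
    proof (intro conjI)
      show "countable ((\<lambda>x. cball x r) ` X)" using X(1) by (intro countable_finite) simp
      show "disjoint ((\<lambda>x. cball x r) ` X)"
        using X(3) by (rule disjoint_family_on_disjoint_image)
      show "\<forall>B\<in>(\<lambda>x. cball x r) ` X. \<exists>x\<in>F. \<exists>r. 0 < r \<and> r \<le> \<delta> \<and> B = cball x r"
        using X(2) r by fast
    qed
    have "closure F \<subseteq> (\<Union>x\<in>X. cball x (2 * r))"
      using X(1,4) by (intro closure_minimal closed_UN) auto
    then have "prob (closure F) \<le> prob (\<Union>x\<in>X. cball x \<rho>)"
      using X(1) \<mu>(2) r(3) by (intro finite_measure_mono) auto
    also have "\<dots> \<le> (\<Sum>x\<in>X. prob (cball x \<rho>))"
      by (rule finite_measure_subadditive_finite[OF X(1)]) (simp add: \<mu>(2) image_subset_iff)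
    also have "\<dots> \<le> (\<Sum>x\<in>X. C * \<rho> powr s')"
    proof (rule sum_mono)
      fix x
      have "\<rho> powr s \<le> \<rho> powr s'" using \<rho>(1,2) assms(5) by (intro powr_mono') auto
      then show "prob (cball x \<rho>) \<le> C * \<rho> powr s'"
        using \<rho>(3)[of x] assms(4) by (meson less_imp_le mult_left_mono order_trans)
    qed
    finally have "prob (closure F) / C \<le> (\<Sum>x\<in>X. \<rho> powr s')"
      using assms(4) by (simp add: field_simps)
    also have "\<dots> = (\<Sum>x\<in>X. diameter (cball x r) powr s')" using r by simp
    also have "\<dots> = (\<Sum>B\<in>(\<lambda>x. cball x r) ` X. diameter B powr s')"
      using inj by (simp only: sum.reindex o_def)
    finally have "ennreal (prob (closure F) / C)
        \<le> (\<Sum>B\<in>(\<lambda>x. cball x r) ` X. ennreal (diameter B powr s'))"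
      by (simp add: sum_ennreal ennreal_leI)
    also have "\<dots> = (\<Sum>\<^sub>\<infinity>B\<in>(\<lambda>x. cball x r) ` X. ennreal (diameter B powr s'))"
      using X(1) by (simp add: infsum_finite)
    also have "\<dots> \<le> packing_content s' \<delta> F"
      unfolding packing_content_def using packing by (intro Sup_upper) blast
    finally show "ennreal (prob (closure F) / C) \<le> packing_content s' \<delta> F" .
  qed
  then have "ennreal C * ennreal (prob (closure F) / C) \<le> ennreal C * packing_premeasure s' F"
    by (rule mult_left_mono) simp
  then show ?thesis using assms(4) by (simp add: emeasure_eq_measure flip: ennreal_mult)
qed

lemma packing_premeasure_mono:
  assumes "A \<subseteq> B"
  shows "packing_premeasure s A \<le> packing_premeasure s B"
proof -
  have "packing_content s \<delta> A \<le> packing_content s \<delta> B" for \<delta>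
    unfolding packing_content_def
    by (rule Sup_subset_mono) (use assms in \<open>fastforce simp: is_packing_def\<close>)
  then show ?thesis unfolding packing_premeasure_def by (intro INF_mono) auto
qed

text \<open>
  The closures of the pieces of \<open>E\<close> cover \<open>E\<close>, so their masses sum to at least one; the preceding
  estimate turns this into a positive lower bound on the sum of the premeasures.
\<close>

lemma packing_measure_ne_0:
  fixes E :: "'a::euclidean_space set"
  assumes \<mu>: "\<mu> \<in> borel_prob_measures_on E" and "compact E" and "0 < C" and "s' \<le> s"
    and mass: "\<exists>\<^sub>F r in at_right 0. \<forall>x. measure \<mu> (cball x r) \<le> C * r powr s"
  shows "packing_measure s' E \<noteq> 0"
proof -
  interpret prob_space \<mu> using \<mu> by (simp add: borel_prob_measures_on_def)
  have sets: "sets \<mu> = sets borel" using \<mu> by (simp add: borel_prob_measures_on_def)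
  have "ennreal (1 / C) \<le> packing_measure s' E"
    unfolding packing_measure_def
  proof (rule Inf_greatest, clarify)
    fix F :: "nat \<Rightarrow> 'a set" assume F: "E \<subseteq> (\<Union>i. F i)"
    have bdd: "bounded (F i \<inter> E)" for i using compact_imp_bounded[OF assms(2)] by auto
    have cover: "E \<subseteq> (\<Union>i. closure (F i \<inter> E))"
    proof
      fix x assume x: "x \<in> E"
      with F obtain i where "x \<in> F i" by auto
      then have "x \<in> closure (F i \<inter> E)" 
        using x by (intro subsetD[OF closure_subset]) simp
      then show "x \<in> (\<Union>i. closure (F i \<inter> E))" by (rule UN_I[OF UNIV_I])
    qed
    have "prob (\<Union>i. closure (F i \<inter> E)) = 1"
      by (rule measure_eq_1_of_superset[OF \<mu> borel_compact[OF assms(2)] _ cover]) simp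
    then have "1 = emeasure \<mu> (\<Union>i. closure (F i \<inter> E))" by (simp add: emeasure_eq_measure)
    also have "\<dots> \<le> (\<Sum>i. emeasure \<mu> (closure (F i \<inter> E)))"
      by (rule emeasure_subadditive_countably) (simp add: sets image_subset_iff)
    also have "\<dots> \<le> (\<Sum>i. ennreal C * packing_premeasure s' (F i))"
    proof (rule suminf_le)
      fix i
      have "emeasure \<mu> (closure (F i \<inter> E)) \<le> ennreal C * packing_premeasure s' (F i \<inter> E)"
        using prob_space_axioms sets bdd assms(3,4) mass
        by (rule measure_closure_le_packing_premeasure)
      also have "\<dots> \<le> ennreal C * packing_premeasure s' (F i)"
        by (intro mult_left_mono packing_premeasure_mono) auto
      finally show "emeasure \<mu> (closure (F i \<inter> E)) \<le> ennreal C * packing_premeasure s' (F i)" .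
    qed auto
    also have "\<dots> = ennreal C * (\<Sum>i. packing_premeasure s' (F i))" by simp
    finally have "ennreal (1 / C) * 1
        \<le> ennreal (1 / C) * (ennreal C * (\<Sum>i. packing_premeasure s' (F i)))"
      by (rule mult_left_mono) simp
    also have "\<dots> = (ennreal (1 / C) * ennreal C) * (\<Sum>i. packing_premeasure s' (F i))"
      by (simp only: mult.assoc)
    also have "ennreal (1 / C) * ennreal C = 1" using assms(3) by (simp flip: ennreal_mult)
    finally show "ennreal (1 / C) \<le> (\<Sum>i. packing_premeasure s' (F i))" by simp
  qed
  then show ?thesis using assms(3) by auto
qed

lemma packing_dim_eq:
  fixes E :: "'a::euclidean_space set"
  assumes \<mu>: "\<mu> \<in> borel_prob_measures_on E" and "compact E" and "0 < C" and "0 \<le> s"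
    and lower: "\<And>x r. x \<in> E \<Longrightarrow> 0 < r \<Longrightarrow> r < 1 \<Longrightarrow> r powr s / C \<le> measure \<mu> (cball x r)"
    and upper: "\<exists>\<^sub>F r in at_right 0. \<forall>x. measure \<mu> (cball x r) \<le> C * r powr s"
  shows "packing_dim E = ereal s"
proof (rule antisym)
  have null: "packing_measure s' E = 0" if "s < s'" for s'
    using \<mu> assms(3) that lower
    by (intro packing_measure_eq_0[of \<mu> C s s']) (auto simp: borel_prob_measures_on_def)
  show "packing_dim E \<le> ereal s"
  proof (rule ereal_le_epsilon2)
    fix e :: real assume "0 < e"
    then show "packing_dim E \<le> ereal s + ereal e"
      unfolding packing_dim_def using null[of "s + e"] assms(4)
      by (intro Inf_lower) (auto intro!: exI[of _ "s + e"])
  qed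
  show "ereal s \<le> packing_dim E"
    unfolding packing_dim_def
  proof (rule Inf_greatest, clarify)
    fix s' assume "packing_measure s' E = 0"
    then show "ereal s \<le> ereal s'"
      using packing_measure_ne_0[OF \<mu> assms(2,3) _ upper, of s'] by (cases "s' \<le> s") auto
  qed
qed


section \<open>Digit positions with oscillating density\<close>

text \<open>
  The first component counts the positions chosen below \<open>m\<close>; the second tells whether positions are
  currently being chosen. The direction changes only when the count meets the upper line \<open>s m\<close> or the
  lower line \<open>t m\<close>. At the lower line a position is chosen in the same step, which keeps the count at
  least \<open>t m - 1\<close>.
\<close>

primrec hysteresis_count :: "real \<Rightarrow> real \<Rightarrow> nat \<Rightarrow> nat \<times> bool" where
  "hysteresis_count t s 0 = (0, True)"
| "hysteresis_count t s (Suc m) =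
    (let (c, up) = hysteresis_count t s m in
     if up then (if s * real m \<le> real c then (c, False) else (Suc c, True))
     else (if real c \<le> t * real m then (Suc c, True) else (c, False)))"

text \<open>
  The count stays within distance one of the strip between the two lines. As the slopes lie strictly
  between 0 and 1, a count that grows by one in each step eventually meets the line of slope \<open>s\<close>, and a
  constant count the line of slope \<open>t\<close>; so the direction changes infinitely often.
\<close>

lemma exists_set_with_oscillating_density:
  fixes s t :: real
  assumes "0 < t" and "t < s" and "s < 1"
  obtains S :: "nat set" where
    "\<And>m. t * real m - 1 \<le> real (card (S \<inter> {..<m}))"
    "\<And>m. real (card (S \<inter> {..<m})) \<le> s * real m + 1"
    "\<And>M. \<exists>m\<ge>M. s * real m \<le> real (card (S \<inter> {..<m}))"
    "\<And>M. \<exists>m\<ge>M. real (card (S \<inter> {..<m})) \<le> t * real m"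
proof -
  define c where "c m = fst (hysteresis_count t s m)" for m
  define up where "up m = snd (hysteresis_count t s m)" for m
  have st: "hysteresis_count t s m = (c m, up m)" for m by (simp add: c_def up_def)
  have c0: "c 0 = 0" by (simp add: c_def)
  have step: "(c (Suc m), up (Suc m)) =
     (if up m then (if s * real m \<le> real (c m) then (c m, False) else (Suc (c m), True))
     else (if real (c m) \<le> t * real m then (Suc (c m), True) else (c m, False)))" for m
    using st[of "Suc m"] by (simp add: st)
  have lower: "t * real m - 1 \<le> real (c m)" for m
  proof (induction m)
    case (Suc m)
    have "t * real m \<le> s * real m" using assms(2) by (intro mult_right_mono) auto
    with Suc step[of m] assms show ?case by (auto simp: algebra_simps split: if_splits)
  qed (simp add: c0)
  have upper: "real (c m) \<le> s * real m + 1" for m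
  proof (induction m)
    case (Suc m)
    have "t * real m \<le> s * real m" using assms(2) by (intro mult_right_mono) auto
    with Suc step[of m] assms show ?case by (auto simp: algebra_simps split: if_splits)
  qed (simp add: c0)
  have turn_down: "\<exists>m\<ge>M. up m \<and> s * real m \<le> real (c m)" if "up M" for M
  proof (rule ccontr)
    assume no: "\<not> ?thesis"
    have grow: "up (M + k) \<and> c (M + k) = c M + k" for k
    proof (induction k)
      case (Suc k)
      then have "\<not> s * real (M + k) \<le> real (c (M + k))" using no le_add1 by blast
      then show ?case using Suc step[of "M + k"] by simp
    qed (use that in simp)
    obtain k :: nat where "s * real M / (1 - s) < real k" using reals_Archimedean2 by blast
    then have "s * real (M + k) < real k" using assms(3) by (simp add: field_simps)
    then have "s * real (M + k) \<le> real (c (M + k))" using grow[of k] by simp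
    then show False using no grow[of k] le_add1 by blast
  qed
  have turn_up: "\<exists>m\<ge>M. \<not> up m \<and> real (c m) \<le> t * real m" if "\<not> up M" for M
  proof (rule ccontr)
    assume no: "\<not> ?thesis"
    have stay: "\<not> up (M + k) \<and> c (M + k) = c M" for k
    proof (induction k)
      case (Suc k)
      then have "\<not> real (c (M + k)) \<le> t * real (M + k)" using no le_add1 by blast
      then show ?case using Suc step[of "M + k"] by simp
    qed (use that in simp)
    obtain k :: nat where "real (c M) / t < real k" using reals_Archimedean2 by blast
    then have "real (c M) < t * real k" using assms(1) by (simp add: field_simps)
    also have "\<dots> \<le> t * real (M + k)" using assms(1) by (intro mult_left_mono) auto
    finally have "real (c (M + k)) \<le> t * real (M + k)" using stay[of k] by simp
    then show False using no stay[of k] le_add1 by blast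
  qed
  have up_again: "\<exists>m\<ge>M. up m" for M
  proof (cases "up M")
    case False
    then obtain m where "m \<ge> M" "\<not> up m" "real (c m) \<le> t * real m" using turn_up by blast
    then show ?thesis using step[of m] by (intro exI[of _ "Suc m"]) auto
  qed auto
  have down_again: "\<exists>m\<ge>M. \<not> up m" for M
  proof (cases "up M")
    case True
    then obtain m where "m \<ge> M" "up m" "s * real m \<le> real (c m)" using turn_down by blast
    then show ?thesis using step[of m] by (intro exI[of _ "Suc m"]) auto
  qed auto
  define S where "S = {m. c (Suc m) = Suc (c m)}"
  have card: "card (S \<inter> {..<m}) = c m" for m
  proof (induction m)
    case (Suc m)
    have "S \<inter> {..<Suc m} = (if m \<in> S then insert m (S \<inter> {..<m}) else S \<inter> {..<m})"
      by (auto simp: less_Suc_eq)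
    then show ?case using Suc step[of m] by (auto simp: S_def split: if_splits)
  qed (simp add: c0)
  show ?thesis
  proof
    show "\<exists>m\<ge>M. s * real m \<le> real (card (S \<inter> {..<m}))" for M
      unfolding card using up_again[of M] turn_down by (meson order_trans)
    show "\<exists>m\<ge>M. real (card (S \<inter> {..<m})) \<le> t * real m" for M
      unfolding card using down_again[of M] turn_up by (meson order_trans)
  qed (simp_all add: card lower upper)
qed

section \<open>Random binary expansions\<close>

text \<open>
  Working with the integer formed by the first \<open>m\<close> digits avoids the ambiguity of binary expansions of
  reals: digits at positions in \<open>S\<close> are recovered uniquely, even though \<open>binary_value\<close> need not
  be injective.
\<close>

primrec prefix_value :: "nat set \<Rightarrow> (nat \<Rightarrow> bool) \<Rightarrow> nat \<Rightarrow> nat" where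
  "prefix_value S \<omega> 0 = 0"
| "prefix_value S \<omega> (Suc m) = 2 * prefix_value S \<omega> m + of_bool (m \<in> S \<and> \<omega> m)"

definition binary_value :: "nat set \<Rightarrow> (nat \<Rightarrow> bool) \<Rightarrow> real" where
  "binary_value S \<omega> = (\<Sum>k. of_bool (k \<in> S \<and> \<omega> k) * (1 / 2) ^ Suc k)"

lemma prefix_value_eq_iff:
  "prefix_value S \<omega> m = prefix_value S \<omega>' m \<longleftrightarrow> (\<forall>k\<in>S \<inter> {..<m}. \<omega> k = \<omega>' k)"
proof (induction m)
  case (Suc m)
  have parity: "Suc (2 * i) \<noteq> 2 * j" for i j :: nat by presburger
  have "prefix_value S \<omega> (Suc m) = prefix_value S \<omega>' (Suc m) \<longleftrightarrow>
      prefix_value S \<omega> m = prefix_value S \<omega>' m \<and> (m \<in> S \<longrightarrow> \<omega> m = \<omega>' m)"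
    using parity[of "prefix_value S \<omega> m" "prefix_value S \<omega>' m"]
      parity[of "prefix_value S \<omega>' m" "prefix_value S \<omega> m"] by auto
  then show ?case using Suc by (auto simp: less_Suc_eq)
qed simp

text \<open>
  The tail after the first \<open>m\<close> digits is dominated by a geometric series with sum \<open>2\<^sup>-\<^sup>m\<close>.
\<close>

lemma binary_value_bounds:
  shows "real (prefix_value S \<omega> m) \<le> 2 ^ m * binary_value S \<omega>"
    and "2 ^ m * binary_value S \<omega> \<le> real (prefix_value S \<omega> m) + 1"
proof -
  define f :: "nat \<Rightarrow> real" where "f k = of_bool (k \<in> S \<and> \<omega> k) * (1 / 2) ^ Suc k" for k
  have geo: "(\<lambda>k. (1 / 2) ^ Suc (k + n)) sums ((1 / 2 :: real) ^ n)" for n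
    using sums_mult[OF power_half_series, of "(1 / 2) ^ n"] by (simp add: power_add mult_ac)
  have f: "0 \<le> f k" "f k \<le> (1 / 2) ^ Suc k" for k by (auto simp: f_def)
  have summable: "summable f"
    by (rule summable_comparison_test'[OF sums_summable[OF geo[of 0]]])
      (use f in \<open>simp add: abs_of_nonneg\<close>)
  have head: "2 ^ m * (\<Sum>k<m. f k) = real (prefix_value S \<omega> m)"
  proof (induction m)
    case (Suc m)
    have "2 ^ Suc m * (\<Sum>k<Suc m. f k) = 2 * (2 ^ m * (\<Sum>k<m. f k)) + 2 ^ Suc m * f m"
      by (simp add: algebra_simps)
    also have "2 ^ Suc m * f m = of_bool (m \<in> S \<and> \<omega> m)"
      by (simp add: f_def power_one_over)
    finally show ?case using Suc by simp
  qed simp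
  have split: "binary_value S \<omega> = (\<Sum>k. f (k + m)) + (\<Sum>k<m. f k)"
    unfolding binary_value_def f_def[symmetric] by (rule suminf_split_initial_segment[OF summable])
  have sum': "summable (\<lambda>k. f (k + m))" using summable by (rule summable_ignore_initial_segment)
  have "0 \<le> (\<Sum>k. f (k + m))" using sum' f(1) by (rule suminf_nonneg)
  moreover have "(\<Sum>k. f (k + m)) \<le> (\<Sum>k. (1 / 2) ^ Suc (k + m))"
    using f(2) sum' sums_summable[OF geo] by (rule suminf_le)
  then have "(\<Sum>k. f (k + m)) \<le> (1 / 2) ^ m" using sums_unique[OF geo[of m]] by simp
  then have "2 ^ m * (\<Sum>k. f (k + m)) \<le> 1" by (simp add: field_simps power_one_over)
  ultimately show "real (prefix_value S \<omega> m) \<le> 2 ^ m * binary_value S \<omega>"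
    and "2 ^ m * binary_value S \<omega> \<le> real (prefix_value S \<omega> m) + 1"
    using head unfolding split by (auto simp: algebra_simps)
qed

abbreviation coin_space :: "(nat \<Rightarrow> bool) measure" where
  "coin_space \<equiv> Pi\<^sub>M UNIV (\<lambda>_. measure_pmf (bernoulli_pmf (1 / 2)))"

lemma space_coin_space: "space coin_space = UNIV"
  by (simp add: space_PiM)

lemma cylinder:
  assumes "finite J"
  shows "{\<omega>. \<forall>k\<in>J. \<omega> k = p k} \<in> sets coin_space"
    and "measure coin_space {\<omega>. \<forall>k\<in>J. \<omega> k = p k} = (1 / 2) ^ card J"
proof -
  let ?M = "\<lambda>_::nat. measure_pmf (bernoulli_pmf (1 / 2))"
  have cyl: "restrict \<omega> J \<in> Pi\<^sub>E J (\<lambda>k. {p k}) \<longleftrightarrow> (\<forall>k\<in>J. \<omega> k = p k)" for \<omega>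
    unfolding PiE_iff by simp
  have emb: "prod_emb UNIV ?M J X = {\<omega>. restrict \<omega> J \<in> X}" for X
    unfolding prod_emb_def vimage_def PiE_UNIV_domain space_measure_pmf by simp
  have eq: "prod_emb UNIV ?M J (Pi\<^sub>E J (\<lambda>k. {p k})) = {\<omega>. \<forall>k\<in>J. \<omega> k = p k}"
    unfolding emb cyl ..
  show "{\<omega>. \<forall>k\<in>J. \<omega> k = p k} \<in> sets coin_space"
    unfolding eq[symmetric] using assms by (intro sets_PiM_I) auto
  have half: "emeasure (?M k) {p k} = ennreal (1 / 2)" for k
    by (cases "p k") (simp_all add: emeasure_pmf_single)
  have "emeasure coin_space {\<omega>. \<forall>k\<in>J. \<omega> k = p k} = (\<Prod>k\<in>J. emeasure (?M k) {p k})"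
    unfolding eq[symmetric]
    by (rule emeasure_PiM_emb) (use assms in \<open>auto intro: prob_space_measure_pmf\<close>)
  also have "\<dots> = ennreal ((1 / 2) ^ card J)"
    unfolding half by (simp only: prod_constant ennreal_power)
  finally show "measure coin_space {\<omega>. \<forall>k\<in>J. \<omega> k = p k} = (1 / 2) ^ card J"
    by (intro measure_eq_emeasure_eq_ennreal) auto
qed

lemma borel_measurable_binary_value: "binary_value S \<in> borel_measurable coin_space"
proof -
  have "(\<lambda>\<omega>. \<omega> k) \<in> measurable coin_space (count_space UNIV)" for k
    using measurable_component_singleton[of k UNIV "\<lambda>_. measure_pmf (bernoulli_pmf (1 / 2))"]
    by (simp cong: measurable_cong_sets)
  then have "(\<lambda>\<omega>. (\<lambda>d. of_bool (k \<in> S \<and> d) * (1 / 2) ^ Suc k :: real) (\<omega> k))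
      \<in> borel_measurable coin_space" for k
    by (rule measurable_compose) simp
  then show ?thesis unfolding binary_value_def[abs_def] by (intro borel_measurable_suminf)
qed

section \<open>The dust and its measure\<close>

definition dust_point :: "nat set \<Rightarrow> (nat \<Rightarrow> bool) \<Rightarrow> 'a::euclidean_space" where
  "dust_point S \<omega> = binary_value S \<omega> *\<^sub>R (SOME b. b \<in> Basis)"

text \<open>
  Taking the closure gives compactness at once, while the distribution of \<open>dust_point S\<close> remains
  supported by the set and ball estimates extend to limit points at the price of doubling the radius.
\<close>

definition dust :: "nat set \<Rightarrow> 'a::euclidean_space set" where
  "dust S = closure (range (dust_point S))"

definition dust_measure :: "nat set \<Rightarrow> 'a::euclidean_space measure" where
  "dust_measure S = distr coin_space borel (dust_point S)"

lemma dust_point_on_axis: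
  obtains b :: "'a::euclidean_space" where "b \<in> Basis" "dust_point S = (\<lambda>\<omega>. binary_value S \<omega> *\<^sub>R b)"
proof
  show "(SOME b :: 'a. b \<in> Basis) \<in> Basis"
    using nonempty_Basis by (rule some_in_eq[THEN iffD2])
qed (simp add: dust_point_def fun_eq_iff)

lemma compact_dust: "compact (dust S :: 'a::euclidean_space set)"
proof -
  obtain b :: 'a where b: "b \<in> Basis" "dust_point S = (\<lambda>\<omega>. binary_value S \<omega> *\<^sub>R b)"
    by (rule dust_point_on_axis)
  have "dust_point S \<omega> \<in> (cball 0 1 :: 'a set)" for \<omega>
    using binary_value_bounds[where S = S and \<omega> = \<omega> and m = 0] b(1) by (simp add: b(2))
  then have "range (dust_point S) \<subseteq> (cball 0 1 :: 'a set)" by (simp add: image_subset_iff)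
  then show ?thesis unfolding dust_def
    using bounded_subset[OF bounded_cball] by (simp add: compact_closure)
qed

lemma dust_nonempty: "dust S \<noteq> {}"
  by (simp add: dust_def)

lemma measurable_dust_point: "(dust_point S :: _ \<Rightarrow> 'a::euclidean_space) \<in> measurable coin_space borel"
  unfolding dust_point_def[abs_def]
  using borel_measurable_binary_value by (intro borel_measurable_scaleR) simp_all

lemma prob_space_coin_space: "prob_space coin_space"
  by (intro prob_space_PiM) (rule prob_space_measure_pmf)

lemma dust_measure_supported:
  "dust_measure S \<in> borel_prob_measures_on (dust S :: 'a::euclidean_space set)"
proof -
  have "UNIV - dust S \<in> sets (borel :: 'a measure)"
    by (intro borel_open open_Diff open_UNIV compact_imp_closed compact_dust)
  then have "emeasure (dust_measure S) (UNIV - dust S :: 'a set)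
      = emeasure coin_space (dust_point S -` (UNIV - dust S :: 'a set) \<inter> space coin_space)"
    unfolding dust_measure_def by (rule emeasure_distr[OF measurable_dust_point])
  also have "dust_point S \<omega> \<in> (dust S :: 'a set)" for \<omega>
    unfolding dust_def by (rule subsetD[OF closure_subset rangeI])
  then have "dust_point S -` (UNIV - dust S :: 'a set) \<inter> space coin_space = {}" by auto
  finally have "emeasure (dust_measure S) (UNIV - dust S :: 'a set) = 0" by simp
  moreover have "prob_space (dust_measure S :: 'a measure)"
    unfolding dust_measure_def
    by (rule prob_space.prob_space_distr[OF prob_space_coin_space measurable_dust_point])
  ultimately show ?thesis by (simp add: borel_prob_measures_on_def dust_measure_def)
qed

lemma dust_measure_cball:
  fixes x :: "'a::euclidean_space"
  shows "measure (dust_measure S) (cball x r) = measure coin_space {\<omega>. dist x (dust_point S \<omega>) \<le> r}"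
    and "{\<omega>. dist x (dust_point S \<omega>) \<le> r} \<in> sets coin_space"
proof -
  have eq: "dust_point S -` cball x r \<inter> space coin_space = {\<omega>. dist x (dust_point S \<omega>) \<le> r}"
    by (simp add: space_coin_space vimage_def)
  have ball: "cball x r \<in> sets borel" by simp
  show "measure (dust_measure S) (cball x r) = measure coin_space {\<omega>. dist x (dust_point S \<omega>) \<le> r}"
    unfolding dust_measure_def measure_distr[OF measurable_dust_point ball] eq ..
  show "{\<omega>. dist x (dust_point S \<omega>) \<le> r} \<in> sets coin_space"
    unfolding eq[symmetric] using measurable_dust_point ball by (rule measurable_sets)
qed

text \<open>
  Projected to the axis, the ball is an interval of length at most \<open>2 \<sqdot> 2\<^sup>-\<^sup>m\<close>. It restricts the first
  \<open>m\<close> digits, read as an integer, to an interval of length three and thus to at most four values, each of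
  which fixes all random digits below \<open>m\<close>.
\<close>

lemma dust_measure_cball_le:
  fixes x :: "'a::euclidean_space"
  assumes "r \<le> (1 / 2) ^ m"
  shows "measure (dust_measure S) (cball x r) \<le> 4 * (1 / 2) ^ card (S \<inter> {..<m})"
proof -
  interpret prob_space coin_space by (rule prob_space_coin_space)
  obtain b :: 'a where b: "b \<in> Basis" and point: "dust_point S = (\<lambda>\<omega>. binary_value S \<omega> *\<^sub>R b)"
    by (rule dust_point_on_axis)
  define y where "y = 2 ^ m * (x \<bullet> b)"
  define V where "V = {v::nat. y - 2 \<le> real v \<and> real v \<le> y + 1}"
  have sub: "int ` V \<subseteq> {\<lceil>y\<rceil> - 2..\<lceil>y\<rceil> + 1}" unfolding V_def by (auto; linarith)
  have "finite (int ` V)" using sub by (rule finite_subset) simp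
  moreover have "card (int ` V) \<le> 4" using card_mono[OF finite_atLeastAtMost_int sub] by simp
  ultimately have V: "finite V" "card V \<le> 4"
    by (simp_all add: card_image finite_image_iff)
  have prefix: "{\<omega>. prefix_value S \<omega> m = v} \<in> events \<and>
      prob {\<omega>. prefix_value S \<omega> m = v} \<le> (1 / 2) ^ card (S \<inter> {..<m})" for v
  proof (cases "\<exists>p. prefix_value S p m = v")
    case True
    then obtain p where "prefix_value S p m = v" ..
    then have "{\<omega>. prefix_value S \<omega> m = v} = {\<omega>. \<forall>k\<in>S \<inter> {..<m}. \<omega> k = p k}"
      using prefix_value_eq_iff[of S _ m p] by auto
    then show ?thesis using cylinder[of "S \<inter> {..<m}" p] by simp
  qed simp
  have "{\<omega>. dist x (binary_value S \<omega> *\<^sub>R b) \<le> r} \<subseteq> (\<Union>v\<in>V. {\<omega>. prefix_value S \<omega> m = v})"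
  proof clarify
    fix \<omega> assume d: "dist x (binary_value S \<omega> *\<^sub>R b) \<le> r"
    have "\<bar>(x - binary_value S \<omega> *\<^sub>R b) \<bullet> b\<bar> \<le> dist x (binary_value S \<omega> *\<^sub>R b)"
      unfolding dist_norm using b by (rule Basis_le_norm)
    then have "\<bar>x \<bullet> b - binary_value S \<omega>\<bar> \<le> (1 / 2) ^ m"
      using d assms b by (simp add: inner_diff_left inner_Basis)
    then have "2 ^ m * \<bar>x \<bullet> b - binary_value S \<omega>\<bar> \<le> 2 ^ m * (1 / 2) ^ m"
      by (rule mult_left_mono) simp
    also have "2 ^ m * \<bar>x \<bullet> b - binary_value S \<omega>\<bar> = \<bar>y - 2 ^ m * binary_value S \<omega>\<bar>"
      unfolding y_def by (simp add: abs_mult flip: right_diff_distrib)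
    also have "2 ^ m * (1 / 2) ^ m = (1 :: real)" by (simp add: power_one_over)
    finally have "\<bar>y - 2 ^ m * binary_value S \<omega>\<bar> \<le> 1" .
    then have "prefix_value S \<omega> m \<in> V"
      unfolding V_def using binary_value_bounds[where S = S and \<omega> = \<omega> and m = m] by auto
    then show "\<omega> \<in> (\<Union>v\<in>V. {\<omega>. prefix_value S \<omega> m = v})" by simp
  qed
  then have "prob {\<omega>. dist x (binary_value S \<omega> *\<^sub>R b) \<le> r} \<le> prob (\<Union>v\<in>V. {\<omega>. prefix_value S \<omega> m = v})"
    by (rule finite_measure_mono) (use V(1) prefix in \<open>intro sets.finite_UN, auto\<close>)
  also have "\<dots> \<le> (\<Sum>v\<in>V. prob {\<omega>. prefix_value S \<omega> m = v})"
    by (rule finite_measure_subadditive_finite[OF V(1)]) (use prefix in blast)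
  also have "\<dots> \<le> (\<Sum>v\<in>V. (1 / 2) ^ card (S \<inter> {..<m}))"
    using prefix by (intro sum_mono) simp
  also have "\<dots> = real (card V) * (1 / 2) ^ card (S \<inter> {..<m})" by simp
  also have "\<dots> \<le> 4 * (1 / 2) ^ card (S \<inter> {..<m})"
    using V(2) by (intro mult_right_mono) auto
  finally show ?thesis by (simp add: dust_measure_cball(1) point)
qed

text \<open>
  Some point of the range is within \<open>2\<^sup>-\<^sup>m\<close> of \<open>x\<close>, and all points that share its first \<open>m\<close> digits are
  within \<open>2\<^sup>-\<^sup>m\<close> of it.
\<close>

lemma dust_measure_cball_ge:
  fixes x :: "'a::euclidean_space"
  assumes "x \<in> dust S"
  shows "(1 / 2) ^ card (S \<inter> {..<m}) \<le> measure (dust_measure S) (cball x (2 * (1 / 2) ^ m))"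
proof -
  interpret prob_space coin_space by (rule prob_space_coin_space)
  obtain b :: 'a where "b \<in> Basis" and point: "dust_point S = (\<lambda>\<omega>. binary_value S \<omega> *\<^sub>R b)"
    by (rule dust_point_on_axis)
  then have b: "norm b = 1" by simp
  have "0 < (1 / 2 :: real) ^ m" by simp
  with assms obtain p where p: "dist (binary_value S p *\<^sub>R b) x < (1 / 2) ^ m"
    unfolding dust_def point closure_approachable by blast
  let ?Z = "{\<omega>. \<forall>k\<in>S \<inter> {..<m}. \<omega> k = p k}"
  have sub: "?Z \<subseteq> {\<omega>. dist x (binary_value S \<omega> *\<^sub>R b) \<le> 2 * (1 / 2) ^ m}"
  proof clarify
    fix \<omega> assume "\<forall>k\<in>S \<inter> {..<m}. \<omega> k = p k"
    then have "prefix_value S \<omega> m = prefix_value S p m" by (simp add: prefix_value_eq_iff)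
    then have "\<bar>2 ^ m * binary_value S p - 2 ^ m * binary_value S \<omega>\<bar> \<le> 1"
      using binary_value_bounds[where S = S and \<omega> = \<omega> and m = m] binary_value_bounds[where S = S and \<omega> = p and m = m] by auto
    also have "\<bar>2 ^ m * binary_value S p - 2 ^ m * binary_value S \<omega>\<bar>
        = 2 ^ m * \<bar>binary_value S p - binary_value S \<omega>\<bar>"
      by (simp add: abs_mult flip: right_diff_distrib)
    finally have "\<bar>binary_value S p - binary_value S \<omega>\<bar> \<le> (1 / 2) ^ m"
      by (simp add: field_simps power_one_over)
    then have "dist (binary_value S p *\<^sub>R b) (binary_value S \<omega> *\<^sub>R b) \<le> (1 / 2) ^ m"
      using b by (simp add: dist_norm flip: scaleR_diff_left)
    then show "dist x (binary_value S \<omega> *\<^sub>R b) \<le> 2 * (1 / 2) ^ m"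
      using p dist_triangle[of x "binary_value S \<omega> *\<^sub>R b" "binary_value S p *\<^sub>R b"]
      by (simp add: dist_commute)
  qed
  have "(1 / 2) ^ card (S \<inter> {..<m}) = prob ?Z" by (simp add: cylinder)
  also have "\<dots> \<le> prob {\<omega>. dist x (binary_value S \<omega> *\<^sub>R b) \<le> 2 * (1 / 2) ^ m}"
    using sub dust_measure_cball(2)[of x S, unfolded point] by (rule finite_measure_mono)
  finally show ?thesis by (simp add: dust_measure_cball(1) point)
qed

lemma dyadic_scale:
  fixes r :: real
  assumes "0 < r" and "r < 1"
  obtains m :: nat where "(1 / 2) ^ Suc m < r" "r \<le> (1 / 2) ^ m"
proof -
  obtain n where n: "(1 / 2) ^ n < r" using real_arch_pow_inv[OF assms(1), of "1 / 2"] by auto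
  define k where "k = (LEAST n. (1 / 2 :: real) ^ n < r)"
  have k: "(1 / 2) ^ k < r" unfolding k_def using n by (rule LeastI)
  then obtain m where m: "k = Suc m" using assms(2) by (cases k) auto
  then have "\<not> (1 / 2) ^ m < r" using not_less_Least[of m "\<lambda>n. (1 / 2 :: real) ^ n < r"] by (simp add: k_def)
  then show ?thesis using k m that[of m] by simp
qed

lemma half_power_eq_powr: "(1 / 2 :: real) ^ m = 2 powr (- real m)"
  by (simp add: powr_minus powr_realpow power_one_over inverse_eq_divide)

lemma half_power_powr: "((1 / 2 :: real) ^ m) powr a = 2 powr (- (a * real m))"
  by (simp add: half_power_eq_powr powr_powr mult.commute)

text \<open>
  The four bounds on the counting function of \<open>S\<close> translate into the four bounds on the masses of balls. The
  constant 16 absorbs the losses from rounding \<open>r\<close> to a power of two, from the four values of the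
  prefix and from the deviation of the count by one.
\<close>

lemma two_scale_measure_exists:
  fixes s t :: real
  assumes "0 < t" and "t < s" and "s < 1"
  obtains E :: "'a::euclidean_space set" and \<mu> C where
    "compact E" "E \<noteq> {}" "\<mu> \<in> borel_prob_measures_on E" "0 < C"
    "\<And>x r. 0 < r \<Longrightarrow> r < 1 \<Longrightarrow> measure \<mu> (cball x r) \<le> C * r powr t"
    "\<And>x r. x \<in> E \<Longrightarrow> 0 < r \<Longrightarrow> r < 1 \<Longrightarrow> r powr s / C \<le> measure \<mu> (cball x r)"
    "\<exists>\<^sub>F r in at_right 0. \<forall>x. measure \<mu> (cball x r) \<le> C * r powr s"
    "\<exists>\<^sub>F r in at_right 0. \<forall>x\<in>E. r powr t / C \<le> measure \<mu> (cball x r)"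
proof -
  obtain S :: "nat set" where S:
    "\<And>m. t * real m - 1 \<le> real (card (S \<inter> {..<m}))"
    "\<And>m. real (card (S \<inter> {..<m})) \<le> s * real m + 1"
    "\<And>M. \<exists>m\<ge>M. s * real m \<le> real (card (S \<inter> {..<m}))"
    "\<And>M. \<exists>m\<ge>M. real (card (S \<inter> {..<m})) \<le> t * real m"
    using exists_set_with_oscillating_density[OF assms] by metis
  let ?c = "\<lambda>m. card (S \<inter> {..<m})"
  let ?\<mu> = "dust_measure S :: 'a measure"
  have two_powr_le: "2 powr a \<le> (2::real)" if "a \<le> 1" for a
    using powr_mono[of a 1 2] that by simp
  have small: "\<exists>M. \<forall>m\<ge>M. 2 * (1 / 2 :: real) ^ m < e" if "0 < e" for e
  proof -
    obtain M where M: "(1 / 2) ^ M < e / 2" using real_arch_pow_inv[of "e / 2" "1 / 2"] \<open>0 < e\<close> by auto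
    have "2 * (1 / 2 :: real) ^ m < e" if "m \<ge> M" for m
    proof -
      have "(1 / 2 :: real) ^ m \<le> (1 / 2) ^ M" using that by (intro power_decreasing) auto
      with M show ?thesis by linarith
    qed
    then show ?thesis by blast
  qed
  show ?thesis
  proof (rule that[OF compact_dust dust_nonempty dust_measure_supported, of 16 S])
    fix x :: 'a and r :: real assume r: "0 < r" "r < 1"
    then obtain m where m: "(1 / 2) ^ Suc m < r" "r \<le> (1 / 2) ^ m" by (rule dyadic_scale)
    have "(1 / 2) ^ ?c m \<le> 2 powr (1 - t * real m)"
      unfolding half_power_eq_powr using S(1)[of m] by (intro powr_mono) auto
    also have "\<dots> = 2 * ((1 / 2) ^ m) powr t"
      unfolding half_power_powr by (simp add: powr_diff powr_minus field_simps)
    also have "\<dots> \<le> 2 * (2 * r) powr t"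
      using m(1) assms(1) by (intro mult_left_mono powr_mono2) auto
    also have "\<dots> = 2 * (2 powr t * r powr t)" using r by (simp add: powr_mult)
    also have "\<dots> \<le> 2 * (2 * r powr t)"
      using two_powr_le[of t] assms by (intro mult_left_mono mult_right_mono) auto
    finally show "measure ?\<mu> (cball x r) \<le> 16 * r powr t"
      using dust_measure_cball_le[OF m(2), of S x] by simp
  next
    fix x :: 'a and r :: real assume x: "x \<in> dust S" and r: "0 < r" "r < 1"
    then obtain m where m: "(1 / 2) ^ Suc m < r" "r \<le> (1 / 2) ^ m" using dyadic_scale by metis
    have "r powr s \<le> ((1 / 2) ^ m) powr s"
      using m(2) r assms by (intro powr_mono2) auto
    then have "r powr s / 16 \<le> 2 powr (- (s * real m)) * 2 powr (- 4)"
      unfolding half_power_powr by (simp add: powr_minus)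
    \<comment> \<open>two more digits leave room for the doubled radius and for the rounding of \<open>r\<close>\<close>
    also have "\<dots> \<le> 2 powr (- real (?c (m + 2)))"
      unfolding powr_add[symmetric] using S(2)[of "m + 2"] assms
      by (intro powr_mono) (auto simp: algebra_simps)
    also have "\<dots> \<le> measure ?\<mu> (cball x (2 * (1 / 2) ^ (m + 2)))"
      unfolding half_power_eq_powr[symmetric] using x by (rule dust_measure_cball_ge)
    also have "\<dots> \<le> measure ?\<mu> (cball x r)"
    proof (rule finite_measure.finite_measure_mono)
      show "finite_measure ?\<mu>"
        using dust_measure_supported[of S] unfolding borel_prob_measures_on_def
        by (auto intro: prob_space.finite_measure)
      show "cball x (2 * (1 / 2) ^ (m + 2)) \<subseteq> cball x r" using m(1) by (intro subset_cball) simp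
      show "cball x r \<in> sets ?\<mu>" by (simp add: dust_measure_def)
    qed
    finally show "r powr s / 16 \<le> measure ?\<mu> (cball x r)" .
  next
    show "\<exists>\<^sub>F r in at_right 0. \<forall>x. measure ?\<mu> (cball x r) \<le> 16 * r powr s"
      unfolding frequently_at_right_0
    proof (intro allI impI)
      fix e :: real assume "0 < e"
      then obtain M where M: "\<And>m. m \<ge> M \<Longrightarrow> 2 * (1 / 2 :: real) ^ m < e" using small by blast
      obtain m where m: "m \<ge> M" "s * real m \<le> real (?c m)" using S(3) by blast
      have "(1 / 2) ^ ?c m \<le> ((1 / 2) ^ m) powr s"
        unfolding half_power_powr half_power_eq_powr[of "?c m"] using m(2) by (intro powr_mono) auto
      then have "measure ?\<mu> (cball x ((1 / 2) ^ m)) \<le> 16 * ((1 / 2) ^ m) powr s" for x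
        using dust_measure_cball_le[OF order_refl, of S x m]
          powr_ge_zero[of "(1 / 2) ^ m" s] by linarith
      moreover have "(1 / 2) ^ m < e" using M[OF m(1)] zero_less_power[of "1 / 2 :: real" m] by linarith
      ultimately show "\<exists>r>0. r < e \<and> (\<forall>x. measure ?\<mu> (cball x r) \<le> 16 * r powr s)"
        by (intro exI[of _ "(1 / 2) ^ m"]) auto
    qed
  next
    show "\<exists>\<^sub>F r in at_right 0. \<forall>x\<in>dust S. r powr t / 16 \<le> measure ?\<mu> (cball x r)"
      unfolding frequently_at_right_0
    proof (intro allI impI)
      fix e :: real assume "0 < e"
      then obtain M where M: "\<And>m. m \<ge> M \<Longrightarrow> 2 * (1 / 2 :: real) ^ m < e" using small by blast
      obtain m where m: "m \<ge> M" "real (?c m) \<le> t * real m" using S(4) by blast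
      have "(2 * (1 / 2) ^ m) powr t = 2 powr t * 2 powr (- (t * real m))"
        by (subst powr_mult) (auto simp: half_power_powr)
      also have "\<dots> \<le> 2 * 2 powr (- real (?c m))"
        using two_powr_le[of t] m(2) assms by (intro mult_mono powr_mono) auto
      finally have "(2 * (1 / 2) ^ m) powr t / 16 \<le> (1 / 2) ^ ?c m"
        unfolding half_power_eq_powr[of "?c m"] using powr_ge_zero[of 2 "- real (?c m)"] by linarith
      then have "(2 * (1 / 2) ^ m) powr t / 16 \<le> measure ?\<mu> (cball x (2 * (1 / 2) ^ m))"
        if "x \<in> dust S" for x
        using dust_measure_cball_ge[OF that, of m] by linarith
      then show "\<exists>r>0. r < e \<and> (\<forall>x\<in>dust S. r powr t / 16 \<le> measure ?\<mu> (cball x r))"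
        using M[OF m(1)] by (intro exI[of _ "2 * (1 / 2) ^ m"]) auto
    qed
  qed simp
qed

theorem proposition3p2:
  fixes s t :: real
  assumes "0 < t" and "t < s" and "s < 1"
  shows "\<exists>E :: (real ^ 'n) set. compact E \<and>
           modified_lower_box_dim E = ereal t \<and> lower_box_dim E = ereal t \<and>
           upper_correlation_dim E = ereal s \<and> packing_dim E = ereal s"
proof -
  obtain E :: "(real ^ 'n) set" and \<mu> C where E: "compact E" "E \<noteq> {}"
    and \<mu>: "\<mu> \<in> borel_prob_measures_on E" and C: "0 < C"
    and le_t: "\<And>x r. 0 < r \<Longrightarrow> r < 1 \<Longrightarrow> measure \<mu> (cball x r) \<le> C * r powr t"
    and ge_s: "\<And>x r. x \<in> E \<Longrightarrow> 0 < r \<Longrightarrow> r < 1 \<Longrightarrow> r powr s / C \<le> measure \<mu> (cball x r)"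
    and le_s: "\<exists>\<^sub>F r in at_right 0. \<forall>x. measure \<mu> (cball x r) \<le> C * r powr s"
    and ge_t: "\<exists>\<^sub>F r in at_right 0. \<forall>x\<in>E. r powr t / C \<le> measure \<mu> (cball x r)"
    by (rule two_scale_measure_exists[OF assms]) (rule that)
  have \<mu>': "prob_space \<mu>" "sets \<mu> = sets borel"
    using \<mu> by (simp_all add: borel_prob_measures_on_def)
  have t_le: "ereal t \<le> modified_lower_box_dim E"
    using \<mu> borel_compact[OF E(1)] C le_t by (rule modified_lower_box_dim_ge)
  have le: "modified_lower_box_dim E \<le> lower_box_dim E"
    using E by (rule modified_lower_box_dim_le_lower_box_dim)
  have le_t': "lower_box_dim E \<le> ereal t"
    using \<mu>' compact_imp_bounded[OF E(1)] E(2) C ge_t by (rule lower_box_dim_le)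
  have "modified_lower_box_dim E = ereal t"
    using order_trans[OF le le_t'] t_le by (rule antisym)
  moreover have "lower_box_dim E = ereal t"
    using le_t' order_trans[OF t_le le] by (rule antisym)
  moreover have "upper_correlation_dim E = ereal s"
  proof (rule antisym)
    show "upper_correlation_dim E \<le> ereal s"
      using \<mu>' E(1) C ge_s by (rule upper_correlation_dim_le)
    show "ereal s \<le> upper_correlation_dim E"
      using \<mu> E(1) C le_s by (rule upper_correlation_dim_ge)
  qed
  moreover have "packing_dim E = ereal s"
    using assms \<mu> E(1) C ge_s le_s by (intro packing_dim_eq[of \<mu> E C s]) auto
  ultimately show ?thesis using E(1) by blast
qed

end
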